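(* Let $R$ be a commutative ring with unity, let $\mathcal{A}$ be a commutative unital $R$-algebra, and let $\sigma,\tau$ be two different non-zero unital $R$-algebra endomorphisms of $\mathcal{A}$. Suppose that, as an $R$-module, $\mathcal{A}$ is of finite rank $n$ and has an $R$-basis of the form $\{1,\alpha,\alpha^{2},\dots,\alpha^{n-1}\}$ for some $\alpha\in\mathcal{A}$. If an $R$-linear map $D:\mathcal{A}\to\mathcal{A}$ is a $(\sigma,\tau)$-derivation, then $$D(\alpha^{k})=\left(\sum_{(i,j)\in S_{k-1}}\sigma(\alpha^{i})\tau(\alpha^{j})\right)D(\alpha)$$ for all $k\in\{1,2,\dots,n-1\}$.
   Context: A $(\sigma,\tau)$-derivation of $\mathcal{A}$ is an $R$-linear map $D:\mathcal{A}\to\mathcal{A}$ with $D(xy)=D(x)\tau(y)+\sigma(x)D(y)$ for all $x,y\in\mathcal{A}$. For a non-negative integer $k$, $S_{k}$ is the set of all ordered pairs $(i,j)$ of non-negative integers with $i+j=k$. *)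

theory Defs
  imports Complex_Main
begin

text \<open>
  Rings are rendered as types of class \<open>comm_ring_1\<close>, and an algebra over \<open>'r\<close> as a ring type \<open>'a\<close>
  with an explicit scalar multiplication. The class excludes the zero ring; a non-zero map into
  \<open>'a\<close> already forces both rings to be non-zero, so nothing is lost under that hypothesis.
\<close>

locale comm_unital_algebra = module scale
  for scale :: "'r::comm_ring_1 \<Rightarrow> 'a::comm_ring_1 \<Rightarrow> 'a" +
  assumes scale_mult_left: "scale r (x * y) = scale r x * y"

definition unital_algebra_endo ::
    "('r::comm_ring_1 \<Rightarrow> 'a::comm_ring_1 \<Rightarrow> 'a) \<Rightarrow> ('a \<Rightarrow> 'a) \<Rightarrow> bool" where
  "unital_algebra_endo scale f \<longleftrightarrow>
     module_hom scale scale f \<and> (\<forall>x y. f (x * y) = f x * f y) \<and> f 1 = 1"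

definition twisted_derivation ::
    "('r::comm_ring_1 \<Rightarrow> 'a::comm_ring_1 \<Rightarrow> 'a) \<Rightarrow> ('a \<Rightarrow> 'a) \<Rightarrow> ('a \<Rightarrow> 'a) \<Rightarrow> ('a \<Rightarrow> 'a) \<Rightarrow> bool" where
  "twisted_derivation scale \<sigma> \<tau> D \<longleftrightarrow>
     module_hom scale scale D \<and> (\<forall>x y. D (x * y) = D x * \<tau> y + \<sigma> x * D y)"

definition module_basis ::
    "('r::comm_ring_1 \<Rightarrow> 'b::ab_group_add \<Rightarrow> 'b) \<Rightarrow> 'b set \<Rightarrow> bool" where
  "module_basis scale B \<longleftrightarrow> \<not> module.dependent scale B \<and> module.span scale B = UNIV"

definition free_of_rank ::
    "('r::comm_ring_1 \<Rightarrow> 'b::ab_group_add \<Rightarrow> 'b) \<Rightarrow> nat \<Rightarrow> bool" where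
  "free_of_rank scale n \<longleftrightarrow> (\<exists>B. module_basis scale B \<and> finite B \<and> card B = n)"

text \<open>
  The powers are required to be pairwise distinct, since the image alone would not record
  repetitions in the family \<open>1, a, \<dots>, a ^ (n - 1)\<close>.
\<close>

definition power_basis ::
    "('r::comm_ring_1 \<Rightarrow> 'a::comm_ring_1 \<Rightarrow> 'a) \<Rightarrow> 'a \<Rightarrow> nat \<Rightarrow> bool" where
  "power_basis scale a n \<longleftrightarrow>
     inj_on (\<lambda>i. a ^ i) {..<n} \<and> module_basis scale ((\<lambda>i. a ^ i) ` {..<n})"

definition sum_pairs :: "nat \<Rightarrow> (nat \<times> nat) set" where
  "sum_pairs k = {(i, j). i + j = k}"

end

theory Submission
  imports Defs
begin

text \<open>Induct on the exponent, peeling off one factor on the right: the twisted Leibniz rule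
  applied to \<open>a ^ k * a\<close> gives
  \<open>D (a ^ k) * \<tau> a + \<sigma> (a ^ k) * D a\<close>. By commutativity \<open>D a\<close>
  factors out. Its coefficient is the old sum times \<open>\<tau> a\<close>, which raises every
  \<tau>-exponent by one, plus the one missing pair \<open>(k, 0)\<close>. This is
  \<open>twisted_derivation_power_Suc\<close>; \<open>sum_sum_pairs\<close> passes between ordered
  pairs and a single index.\<close>

lemma sum_sum_pairs: "(\<Sum>(i, j)\<in>sum_pairs k. f i j) = (\<Sum>i\<le>k. f i (k - i))"
  by (rule sum.reindex_bij_witness[of _ "\<lambda>i. (i, k - i)" fst]) (auto simp: sum_pairs_def)

text \<open>Starting at exponent 1 makes the base case
  \<open>\<sigma> 1 * \<tau> 1 * D a = D a\<close>, and writing the exponent as a successor avoids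
  \<open>k - 1\<close> in the induction.\<close>

lemma twisted_derivation_power_Suc:
  fixes D \<sigma> \<tau> :: "'a::comm_ring_1 \<Rightarrow> 'a"
  assumes mult: "\<And>x y. D (x * y) = D x * \<tau> y + \<sigma> x * D y"
    and \<sigma>: "\<sigma> 1 = 1" and \<tau>: "\<And>x y. \<tau> (x * y) = \<tau> x * \<tau> y" "\<tau> 1 = 1"
  shows "D (a ^ Suc m) = (\<Sum>i\<le>m. \<sigma> (a ^ i) * \<tau> (a ^ (m - i))) * D a"
proof (induction m)
  case 0
  show ?case by (simp add: \<sigma> \<tau>)
next
  case (Suc m)
  \<comment> \<open>These are the pairs of total \<open>Suc m\<close> with positive second entry;
    \<open>i \<le> m\<close> ensures that \<open>Suc m - i\<close> is
    \<open>Suc (m - i)\<close>.\<close>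
  have shift: "(\<Sum>i\<le>m. \<sigma> (a ^ i) * \<tau> (a ^ (m - i))) * \<tau> a =
      (\<Sum>i\<le>m. \<sigma> (a ^ i) * \<tau> (a ^ (Suc m - i)))"
    unfolding sum_distrib_right
    by (intro sum.cong refl) (simp add: Suc_diff_le \<tau>(1) mult_ac)
  have "D (a ^ Suc (Suc m)) = D (a ^ Suc m) * \<tau> a + \<sigma> (a ^ Suc m) * D a"
    using mult[of "a ^ Suc m" a] by (simp add: mult_ac)
  also have "\<dots> = ((\<Sum>i\<le>m. \<sigma> (a ^ i) * \<tau> (a ^ (m - i))) * \<tau> a + \<sigma> (a ^ Suc m)) * D a"
    unfolding Suc.IH by (simp add: algebra_simps)
  \<comment> \<open>The term \<open>\<sigma> (a ^ Suc m)\<close> is the summand at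
    \<open>i = Suc m\<close>, where the \<tau>-factor is \<open>\<tau> 1 = 1\<close>.\<close>
  finally show ?case
    unfolding shift by (simp add: \<tau>(2))
qed

theorem theorem2p19:
  fixes scale :: "'r::comm_ring_1 \<Rightarrow> 'a::comm_ring_1 \<Rightarrow> 'a"
    and \<sigma> \<tau> D :: "'a \<Rightarrow> 'a" and \<alpha> :: 'a and n :: nat
  assumes "comm_unital_algebra scale"
    and "unital_algebra_endo scale \<sigma>" and "unital_algebra_endo scale \<tau>"
    and "\<sigma> \<noteq> \<tau>" and "\<sigma> \<noteq> (\<lambda>_. 0)" and "\<tau> \<noteq> (\<lambda>_. 0)"
    and "free_of_rank scale n" and "power_basis scale \<alpha> n"
    and "twisted_derivation scale \<sigma> \<tau> D"
  shows "\<forall>k\<in>{1..n - 1}.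
    D (\<alpha> ^ k) = (\<Sum>(i, j)\<in>sum_pairs (k - 1). \<sigma> (\<alpha> ^ i) * \<tau> (\<alpha> ^ j)) * D \<alpha>"
proof -
  have mult: "D (x * y) = D x * \<tau> y + \<sigma> x * D y" for x y
    using assms(9) by (simp add: twisted_derivation_def)
  have \<sigma>: "\<sigma> 1 = 1" and \<tau>: "\<And>x y. \<tau> (x * y) = \<tau> x * \<tau> y" "\<tau> 1 = 1"
    using assms(2,3) by (simp_all add: unital_algebra_endo_def)
  show ?thesis
  proof
    fix k assume "k \<in> {1..n - 1}"
    \<comment> \<open>Since \<open>k\<close> is at least 1, the truncated \<open>k - 1\<close> is a
      true predecessor.\<close>
    then obtain m where k: "k = Suc m"
      by (cases k) auto
    have "D (\<alpha> ^ Suc m) = (\<Sum>i\<le>m. \<sigma> (\<alpha> ^ i) * \<tau> (\<alpha> ^ (m - i))) * D \<alpha>"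
      using mult \<sigma> \<tau> by (rule twisted_derivation_power_Suc)
    then show "D (\<alpha> ^ k) = (\<Sum>(i, j)\<in>sum_pairs (k - 1). \<sigma> (\<alpha> ^ i) * \<tau> (\<alpha> ^ j)) * D \<alpha>"
      unfolding k sum_sum_pairs by simp
  qed
qed

end
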